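(* Let $(X,d)$ be a metric space with a unique non-isolated point $x_0$. Then $X$ is $CT_3$, and $X$ is $CT_4$ if and only if it is compact.
   Context: For a space $X$, $\mathrm{Cld}(X)$ denotes the set of all non-empty closed subsets of $X$, endowed with the Vietoris topology, i.e. the topology having as a subbase all sets $U^-=\{F\in\mathrm{Cld}(X): F\cap U\neq\emptyset\}$ and $U^+=\{F\in\mathrm{Cld}(X): F\subseteq U\}$ with $U$ open in $X$. Let $\mathcal{T}_4(X)=\{(F_1,F_2)\in\mathrm{Cld}(X)^2: F_1\cap F_2=\emptyset\}$ and $\mathcal{T}_3(X)=\{(F_1,F_2)\in\mathcal{T}_4(X): F_1\text{ is a singleton}\}$, both with the subspace topology from the product space $\mathrm{Cld}(X)^2$. For $i=3,4$, $X$ is called $CT_i$ if there is a continuous map $\phi=(\phi_1,\phi_2):\mathcal{T}_i(X)\to\mathrm{Cld}(X)^2$ such that for every $(F_1,F_2)\in\mathcal{T}_i(X)$: $\phi_1(F_1,F_2)\cup\phi_2(F_1,F_2)=X$ and $F_j\cap\phi_j(F_1,F_2)=\emptyset$ for $j=1,2$. *)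

theory Defs
  imports "HOL-Analysis.Analysis"
begin

definition Cld :: "'a topology \<Rightarrow> 'a set set"
  where "Cld X = {F. closedin X F \<and> F \<noteq> {}}"

text \<open>The subbasic sets \<open>U\<^sup>-\<close> and \<open>U\<^sup>+\<close>.\<close>

definition hit_set :: "'a topology \<Rightarrow> 'a set \<Rightarrow> 'a set set"
  where "hit_set X U = {F \<in> Cld X. F \<inter> U \<noteq> {}}"

definition sub_set :: "'a topology \<Rightarrow> 'a set \<Rightarrow> 'a set set"
  where "sub_set X U = {F \<in> Cld X. F \<subseteq> U}"

definition vietoris :: "'a topology \<Rightarrow> 'a set topology"
  where "vietoris X =
    topology_generated_by (hit_set X ` {U. openin X U} \<union> sub_set X ` {U. openin X U})"

lemma topspace_vietoris [simp]: "topspace (vietoris X) = Cld X"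
proof -
  have "Cld X = sub_set X (topspace X)"
    by (auto simp: sub_set_def Cld_def dest: closedin_subset)
  then show ?thesis
    unfolding vietoris_def topology_generated_by_topspace
    by (fastforce simp: hit_set_def sub_set_def)
qed

definition T4_pairs :: "'a topology \<Rightarrow> ('a set \<times> 'a set) set"
  where "T4_pairs X = {(F1, F2). F1 \<in> Cld X \<and> F2 \<in> Cld X \<and> F1 \<inter> F2 = {}}"

definition T3_pairs :: "'a topology \<Rightarrow> ('a set \<times> 'a set) set"
  where "T3_pairs X = {(F1, F2) \<in> T4_pairs X. is_singleton F1}"

text \<open>Both \<open>CT\<^sub>3\<close> and \<open>CT\<^sub>4\<close> have this form, with \<open>T\<close> the respective set of pairs.\<close>

definition continuously_separated :: "'a topology \<Rightarrow> ('a set \<times> 'a set) set \<Rightarrow> bool"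
  where "continuously_separated X T \<longleftrightarrow>
    (\<exists>\<phi>. continuous_map
           (subtopology (prod_topology (vietoris X) (vietoris X)) T)
           (prod_topology (vietoris X) (vietoris X)) \<phi> \<and>
         (\<forall>(F1, F2) \<in> T.
           fst (\<phi> (F1, F2)) \<union> snd (\<phi> (F1, F2)) = topspace X \<and>
           F1 \<inter> fst (\<phi> (F1, F2)) = {} \<and> F2 \<inter> snd (\<phi> (F1, F2)) = {}))"

definition CT3_space :: "'a topology \<Rightarrow> bool"
  where "CT3_space X \<longleftrightarrow> continuously_separated X (T3_pairs X)"

definition CT4_space :: "'a topology \<Rightarrow> bool"
  where "CT4_space X \<longleftrightarrow> continuously_separated X (T4_pairs X)"

definition isolated_point :: "'a topology \<Rightarrow> 'a \<Rightarrow> bool"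
  where "isolated_point X x \<longleftrightarrow> x \<in> topspace X \<and> openin X {x}"

end

theory Submission
  imports Defs
begin

text \<open>
  Let \<open>V 0 \<supseteq> V 1 \<supseteq> \<dots>\<close> be a base of neighbourhoods of the only non-isolated point \<open>x0\<close>, with
  \<open>V 0\<close> the whole space. A set that contains \<open>x0\<close> is closed, a set that omits \<open>x0\<close> is open, and
  hence every \<open>V n\<close> is clopen.

  For the existence of \<open>\<phi>\<close>, separate \<open>F\<^sub>1\<close> from \<open>F\<^sub>2\<close> by the clopen set
  \<open>S = F\<^sub>1 \<union> \<Union>{V n | F\<^sub>2 \<inter> V n = {} \<and> F\<^sub>1 \<inter> V n \<noteq> {}}\<close> and put \<open>\<phi> = (X - S, S)\<close>. If some \<open>n\<close>
  contributes to the union, then the union is \<open>V n\<close> for the least \<open>n\<close> such that \<open>V n\<close> misses \<open>F\<^sub>2\<close>,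
  and this \<open>n\<close> is locally constant in the Vietoris topology; otherwise \<open>x0 \<notin> F\<^sub>1\<close> and \<open>S = F\<^sub>1\<close>.
  As soon as all the sets \<open>F\<^sub>1 - V n\<close> are finite, \<open>S\<close> is locally constant, because a finite set of
  isolated points can be prescribed by a Vietoris neighbourhood; so \<open>\<phi>\<close> is continuous
  (\<open>continuously_separatedI\<close>). The finiteness is trivial if \<open>F\<^sub>1\<close> is a singleton, and in a compact
  space it holds because every \<open>X - V n\<close> is finite.

  If the space is not compact, then some \<open>X - V n\<close> is infinite and contains a countably infinite
  closed set \<open>D\<close> of isolated points. Suppose that \<open>\<phi>\<close> witnesses \<open>CT\<^sub>4\<close>. For each nonempty proper
  subset \<open>F\<close> of \<open>D\<close>, the set \<open>\<phi>\<^sub>2 (F, D - F)\<close> meets \<open>D\<close> exactly in \<open>F\<close>, and by continuity the same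
  holds for \<open>\<phi>\<^sub>2 (A\<^sub>1, A\<^sub>2)\<close> with suitable finite \<open>A\<^sub>1 \<subseteq> F\<close> and \<open>A\<^sub>2 \<subseteq> D - F\<close>. Hence the uncountably
  many sets \<open>F\<close> are determined by the countably many pairs \<open>(A\<^sub>1, A\<^sub>2)\<close>, which is absurd
  (\<open>not_CT4_space\<close>).
\<close>

section \<open>Neighbourhoods in the Vietoris topology\<close>

lemma openin_hit_set: "openin X U \<Longrightarrow> openin (vietoris X) (hit_set X U)"
  unfolding vietoris_def by (rule topology_generated_by_Basis) auto

lemma openin_sub_set: "openin X U \<Longrightarrow> openin (vietoris X) (sub_set X U)"
  unfolding vietoris_def by (rule topology_generated_by_Basis) auto

text \<open>A Vietoris neighbourhood of \<open>F\<close> contains all closed subsets of \<open>F\<close> that are large enough,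
  where finitely many points of \<open>F\<close> decide what is large enough.\<close>

lemma vietoris_nbhd_finite_core:
  assumes "openin (vietoris X) W" "F \<in> W"
  obtains A where "finite A" "A \<noteq> {}" "A \<subseteq> F"
    "\<And>F'. F' \<in> Cld X \<Longrightarrow> A \<subseteq> F' \<Longrightarrow> F' \<subseteq> F \<Longrightarrow> F' \<in> W"
proof -
  have "generate_topology_on
      (hit_set X ` {U. openin X U} \<union> sub_set X ` {U. openin X U}) W"
    using assms(1) by (simp add: vietoris_def openin_topology_generated_by_iff)
  then have "F \<in> W \<longrightarrow> (\<exists>A. finite A \<and> A \<subseteq> F \<and>
      (\<forall>F' \<in> Cld X. A \<subseteq> F' \<longrightarrow> F' \<subseteq> F \<longrightarrow> F' \<in> W))"
  proof induction
    case Empty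
    then show ?case by simp
  next
    case (Int a b)
    show ?case
    proof
      assume "F \<in> a \<inter> b"
      with Int.IH obtain A B where
        "finite A \<and> A \<subseteq> F \<and> (\<forall>F' \<in> Cld X. A \<subseteq> F' \<longrightarrow> F' \<subseteq> F \<longrightarrow> F' \<in> a)"
        "finite B \<and> B \<subseteq> F \<and> (\<forall>F' \<in> Cld X. B \<subseteq> F' \<longrightarrow> F' \<subseteq> F \<longrightarrow> F' \<in> b)"
        by auto
      then show "\<exists>A. finite A \<and> A \<subseteq> F \<and>
          (\<forall>F' \<in> Cld X. A \<subseteq> F' \<longrightarrow> F' \<subseteq> F \<longrightarrow> F' \<in> a \<inter> b)"
        by (intro exI[of _ "A \<union> B"]) auto
    qed
  next
    case (UN K)
    then show ?case by (meson Union_iff)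
  next
    case (Basis s)
    then consider U where "s = hit_set X U" | U where "s = sub_set X U" by auto
    then show ?case
    proof cases
      case 1
      show ?thesis
      proof
        assume "F \<in> s"
        then obtain x where "x \<in> F" "x \<in> U" using 1 by (auto simp: hit_set_def)
        then show "\<exists>A. finite A \<and> A \<subseteq> F \<and> (\<forall>F' \<in> Cld X. A \<subseteq> F' \<longrightarrow> F' \<subseteq> F \<longrightarrow> F' \<in> s)"
          using 1 by (intro exI[of _ "{x}"]) (auto simp: hit_set_def)
      qed
    next
      case 2
      then show ?thesis by (auto simp: sub_set_def)
    qed
  qed
  then obtain A where A: "finite A" "A \<subseteq> F"
    "\<forall>F' \<in> Cld X. A \<subseteq> F' \<longrightarrow> F' \<subseteq> F \<longrightarrow> F' \<in> W"
    using assms(2) by blast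
  have "F \<in> Cld X" using openin_subset[OF assms(1)] assms(2) by auto
  then obtain x where "x \<in> F" by (auto simp: Cld_def)
  then show thesis using A that[of "insert x A"] by auto
qed

lemma continuous_map_locally_constant:
  assumes "\<And>x. x \<in> topspace X \<Longrightarrow> f x \<in> topspace Y"
    and "\<And>x. x \<in> topspace X \<Longrightarrow> \<exists>N. openin X N \<and> x \<in> N \<and> (\<forall>y \<in> N. f y = f x)"
  shows "continuous_map X Y f"
  unfolding continuous_map_def
proof (intro conjI allI impI)
  show "f \<in> topspace X \<rightarrow> topspace Y" using assms(1) by auto
  fix U assume "openin Y U"
  show "openin X {x \<in> topspace X. f x \<in> U}"
  proof (subst openin_subopen, intro ballI)
    fix x assume x: "x \<in> {x \<in> topspace X. f x \<in> U}"
    then obtain N where N: "openin X N" "x \<in> N" "\<forall>y \<in> N. f y = f x"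
      using assms(2)[of x] by auto
    have "N \<subseteq> {x \<in> topspace X. f x \<in> U}"
    proof
      fix y assume y: "y \<in> N"
      then have "f y = f x" using N(3) by blast
      then show "y \<in> {x \<in> topspace X. f x \<in> U}"
        using x y openin_subset[OF N(1)] by auto
    qed
    then show "\<exists>N. openin X N \<and> x \<in> N \<and> N \<subseteq> {x \<in> topspace X. f x \<in> U}"
      using N by blast
  qed
qed

section \<open>Infinite closed sets of isolated points exclude \<open>CT\<^sub>4\<close>\<close>

lemma uncountable_Pow_infinite:
  assumes "infinite D"
  shows "uncountable (Pow D)"
proof
  assume c: "countable (Pow D)"
  have "countable ((\<lambda>x. {x}) ` D)" by (rule countable_subset[OF _ c]) auto
  then have "countable D" by (rule countable_image_inj_on) simp
  then have "bij_betw (to_nat_on D) D UNIV" using assms by (rule to_nat_on_infinite)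
  moreover have "range (from_nat_into (Pow D)) = Pow D"
    using c by (intro range_from_nat_into) auto
  ultimately have "(from_nat_into (Pow D) \<circ> to_nat_on D) ` D = Pow D"
    by (metis bij_betw_imp_surj_on image_comp)
  then show False using Cantors_theorem[of D] by blast
qed

text \<open>Every subset of \<open>D\<close> is closed here, so that all partitions of \<open>D\<close> are available as pairs of
  disjoint closed sets.\<close>

lemma not_CT4_space:
  assumes D: "closedin X D" "infinite D" "countable D"
    and isolated: "\<And>x. x \<in> D \<Longrightarrow> openin X {x}"
  shows "\<not> CT4_space X"
proof
  assume "CT4_space X"
  then obtain \<phi> where
    cont: "continuous_map
      (subtopology (prod_topology (vietoris X) (vietoris X)) (T4_pairs X))
      (prod_topology (vietoris X) (vietoris X)) \<phi>"
    and sep: "\<And>F1 F2. (F1, F2) \<in> T4_pairs X \<Longrightarrow>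
      fst (\<phi> (F1, F2)) \<union> snd (\<phi> (F1, F2)) = topspace X \<and>
      F1 \<inter> fst (\<phi> (F1, F2)) = {} \<and> F2 \<inter> snd (\<phi> (F1, F2)) = {}"
    unfolding CT4_space_def continuously_separated_def by fast
  have open_sub: "openin X S" if "S \<subseteq> D" for S
    using that isolated by (subst openin_subopen) blast
  have closed_sub: "closedin X S" if "S \<subseteq> D" for S
  proof -
    have "S = D - (D - S)" using that by auto
    then show ?thesis using closedin_diff[OF D(1) open_sub[of "D - S"]] by auto
  qed
  have Cld_sub: "S \<in> Cld X" if "S \<subseteq> D" "S \<noteq> {}" for S
    using that closed_sub by (simp add: Cld_def)
  have DX: "D \<subseteq> topspace X" using D(1) by (rule closedin_subset)
  let ?P = "subtopology (prod_topology (vietoris X) (vietoris X)) (T4_pairs X)"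
  have finite_code: "F \<in> (\<lambda>p. snd (\<phi> p) \<inter> D) ` (Fpow D \<times> Fpow D)"
    if F: "F \<subseteq> D" "F \<noteq> {}" "F \<noteq> D" for F
  proof -
    have p: "(F, D - F) \<in> T4_pairs X"
      using F by (auto simp: T4_pairs_def intro!: Cld_sub)
    define O1 where "O1 = sub_set X (topspace X - F)"
    define O2 where "O2 = sub_set X (topspace X - (D - F))"
    have O: "openin (prod_topology (vietoris X) (vietoris X)) (O1 \<times> O2)"
      unfolding O1_def O2_def openin_prod_Times_iff
      using F by (intro disjI2 conjI openin_sub_set openin_diff closed_sub) auto
    have tp: "(F, D - F) \<in> topspace ?P"
      using p by (auto simp: T4_pairs_def)
    have "\<phi> (F, D - F) \<in> Cld X \<times> Cld X"
      using continuous_map_image_subset_topspace[OF cont] tp by fastforce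
    then have "fst (\<phi> (F, D - F)) \<in> Cld X" "snd (\<phi> (F, D - F)) \<in> Cld X"
      by (auto simp: mem_Times_iff)
    then have ph: "\<phi> (F, D - F) \<in> O1 \<times> O2"
      using sep[OF p] unfolding O1_def O2_def sub_set_def mem_Times_iff by blast
    have "openin ?P {q \<in> topspace ?P. \<phi> q \<in> O1 \<times> O2}"
      by (rule openin_continuous_map_preimage[OF cont O])
    then obtain W where W: "openin (prod_topology (vietoris X) (vietoris X)) W"
      "{q \<in> topspace ?P. \<phi> q \<in> O1 \<times> O2} = W \<inter> T4_pairs X"
      unfolding openin_subtopology by blast
    have "(F, D - F) \<in> {q \<in> topspace ?P. \<phi> q \<in> O1 \<times> O2}" using tp ph by simp
    then have "(F, D - F) \<in> W" unfolding W(2) by simp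
    then obtain W1 W2 where W12: "openin (vietoris X) W1" "openin (vietoris X) W2"
      "F \<in> W1" "D - F \<in> W2" "W1 \<times> W2 \<subseteq> W"
      using W(1)[unfolded openin_prod_topology_alt] by metis
    obtain A1 where A1: "finite A1" "A1 \<noteq> {}" "A1 \<subseteq> F"
      "\<And>F'. F' \<in> Cld X \<Longrightarrow> A1 \<subseteq> F' \<Longrightarrow> F' \<subseteq> F \<Longrightarrow> F' \<in> W1"
      using vietoris_nbhd_finite_core[OF W12(1,3)] by metis
    obtain A2 where A2: "finite A2" "A2 \<noteq> {}" "A2 \<subseteq> D - F"
      "\<And>F'. F' \<in> Cld X \<Longrightarrow> A2 \<subseteq> F' \<Longrightarrow> F' \<subseteq> D - F \<Longrightarrow> F' \<in> W2"
      using vietoris_nbhd_finite_core[OF W12(2,4)] by metis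
    have A_Cld: "A1 \<in> Cld X" "A2 \<in> Cld X"
      using A1 A2 F by (auto intro!: Cld_sub)
    then have AT: "(A1, A2) \<in> T4_pairs X"
      using A1(3) A2(3) by (auto simp: T4_pairs_def)
    have "(A1, A2) \<in> W1 \<times> W2" using A1 A2 A_Cld by auto
    then have "(A1, A2) \<in> W \<inter> T4_pairs X" using W12(5) AT by blast
    then have "\<phi> (A1, A2) \<in> O1 \<times> O2" unfolding W(2)[symmetric] by simp
    then have "fst (\<phi> (A1, A2)) \<subseteq> topspace X - F"
      "snd (\<phi> (A1, A2)) \<subseteq> topspace X - (D - F)"
      by (auto simp: O1_def O2_def sub_set_def mem_Times_iff)
    \<comment> \<open>The two values cover \<open>D\<close>, so neither inclusion can be strict on \<open>D\<close>.\<close>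
    then have "snd (\<phi> (A1, A2)) \<inter> D = F"
      using sep[OF AT] F(1) DX by blast
    moreover have "(A1, A2) \<in> Fpow D \<times> Fpow D"
      using A1 A2 F(1) by (auto simp: Fpow_def)
    ultimately show ?thesis by (metis (no_types, lifting) image_eqI)
  qed
  have "countable (Fpow D)"
    using countable_Collect_finite_subset[OF D(3)] by (simp add: Fpow_def conj_commute)
  then have "countable ((\<lambda>p. snd (\<phi> p) \<inter> D) ` (Fpow D \<times> Fpow D) \<union> {{}, D})"
    by (intro countable_Un countable_image countable_SIGMA) auto
  moreover have "Pow D \<subseteq> (\<lambda>p. snd (\<phi> p) \<inter> D) ` (Fpow D \<times> Fpow D) \<union> {{}, D}"
    using finite_code by blast
  ultimately have "countable (Pow D)" by (rule countable_subset[rotated])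
  then show False using uncountable_Pow_infinite[OF D(2)] by blast
qed

section \<open>Spaces with one limit point\<close>

text \<open>A space in which all points other than \<open>x0\<close> are isolated, together with a decreasing base
  \<open>V\<close> of neighbourhoods of \<open>x0\<close>. Taking \<open>V 0\<close> to be the whole space ensures that the least \<open>n\<close>
  such that \<open>V n\<close> misses a given nonempty set is positive.\<close>

locale one_limit_point =
  fixes X :: "'a topology" and x0 :: 'a and V :: "nat \<Rightarrow> 'a set"
  assumes isolated: "x \<in> topspace X \<Longrightarrow> x \<noteq> x0 \<Longrightarrow> openin X {x}"
    and open_V: "openin X (V n)"
    and x0_V: "x0 \<in> V n"
    and V_0: "V 0 = topspace X"
    and V_mono: "m \<le> n \<Longrightarrow> V n \<subseteq> V m"
    and V_base: "openin X U \<Longrightarrow> x0 \<in> U \<Longrightarrow> \<exists>n. V n \<subseteq> U"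
begin

lemma x0_topspace: "x0 \<in> topspace X"
  using x0_V[of 0] V_0 by simp

lemma openin_omitting: "S \<subseteq> topspace X \<Longrightarrow> x0 \<notin> S \<Longrightarrow> openin X S"
  using isolated by (subst openin_subopen) blast

lemma openin_containing_V:
  assumes "S \<subseteq> topspace X" "V n \<subseteq> S"
  shows "openin X S"
proof -
  have "S = V n \<union> (S - V n)" using assms by auto
  then show ?thesis
    using openin_Un[OF open_V[of n] openin_omitting[of "S - V n"]] assms x0_V by auto
qed

lemma closedin_containing: "S \<subseteq> topspace X \<Longrightarrow> x0 \<in> S \<Longrightarrow> closedin X S"
  by (simp add: closedin_def openin_omitting)

lemma closedin_misses_V:
  assumes "closedin X F" "x0 \<notin> F"
  obtains n where "F \<inter> V n = {}"
proof -
  have "openin X (topspace X - F)" using assms by blast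
  then obtain n where "V n \<subseteq> topspace X - F" using V_base x0_topspace assms(2) by blast
  then show thesis using that by blast
qed

lemma least_V_missing:
  assumes "F \<in> Cld X" "F \<inter> V n = {}"
  obtains m where "m < n" "F \<inter> V (Suc m) = {}" "F \<inter> V m \<noteq> {}"
proof -
  have "F \<inter> V 0 \<noteq> {}" using assms(1) closedin_subset V_0 by (fastforce simp: Cld_def)
  then obtain m where "m < n" "\<forall>i\<le>m. F \<inter> V i \<noteq> {}" "F \<inter> V (Suc m) = {}"
    using ex_least_nat_less[of "\<lambda>n. F \<inter> V n = {}" n] assms(2) by blast
  then show thesis by (intro that) auto
qed

section \<open>A locally constant separation\<close>

text \<open>The set separating \<open>F1\<close> from \<open>F2\<close>. Since the \<open>V n\<close> decrease, the union is either empty or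
  equal to the largest \<open>V n\<close> that misses \<open>F2\<close>.\<close>

definition sep_set :: "'a set \<Rightarrow> 'a set \<Rightarrow> 'a set"
  where "sep_set F1 F2 = F1 \<union> \<Union>{V n | n. F2 \<inter> V n = {} \<and> F1 \<inter> V n \<noteq> {}}"

lemma sep_set_eq_Un_V:
  assumes "F2 \<inter> V (Suc m) = {}" "F2 \<inter> V m \<noteq> {}" "F1 \<inter> V (Suc m) \<noteq> {}"
  shows "sep_set F1 F2 = F1 \<union> V (Suc m)"
proof -
  have "V n \<subseteq> V (Suc m)" if "F2 \<inter> V n = {}" for n
  proof (rule V_mono, rule ccontr)
    assume "\<not> Suc m \<le> n"
    then have "V m \<subseteq> V n" by (intro V_mono) auto
    then show False using assms(2) that by blast
  qed
  then show ?thesis using assms unfolding sep_set_def by blast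
qed

lemma sep_set_eq_fst:
  assumes "F1 \<inter> V (Suc m) = {}" "F2 \<inter> V m \<noteq> {}"
  shows "sep_set F1 F2 = F1"
proof -
  have "F1 \<inter> V n = {}" if "F2 \<inter> V n = {}" for n
  proof -
    have "\<not> n \<le> m" using V_mono[of n m] assms(2) that by blast
    then show ?thesis using V_mono[of "Suc m" n] assms(1) by auto
  qed
  then show ?thesis unfolding sep_set_def by blast
qed

text \<open>For disjoint closed sets one of the two previous lemmas applies.\<close>

lemma T4_pairs_cases:
  assumes "(F1, F2) \<in> T4_pairs X"
  obtains (near) m where "F2 \<inter> V (Suc m) = {}" "F2 \<inter> V m \<noteq> {}" "F1 \<inter> V (Suc m) \<noteq> {}"
  | (far) m where "F1 \<inter> V (Suc m) = {}" "F2 \<inter> V m \<noteq> {}"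
proof (cases "\<exists>n. F2 \<inter> V n = {} \<and> F1 \<inter> V n \<noteq> {}")
  case True
  then obtain n where n: "F2 \<inter> V n = {}" "F1 \<inter> V n \<noteq> {}" by blast
  then obtain m where m: "m < n" "F2 \<inter> V (Suc m) = {}" "F2 \<inter> V m \<noteq> {}"
    using least_V_missing[of F2 n] assms unfolding T4_pairs_def by blast
  have "F1 \<inter> V (Suc m) \<noteq> {}" using V_mono[of "Suc m" n] m(1) n(2) by auto
  with m(2,3) show thesis by (rule near)
next
  case False
  have "x0 \<notin> F1"
  proof
    assume "x0 \<in> F1"
    then have "closedin X F2" "x0 \<notin> F2" using assms by (auto simp: T4_pairs_def Cld_def)
    then obtain n where "F2 \<inter> V n = {}" by (rule closedin_misses_V)
    with False \<open>x0 \<in> F1\<close> x0_V show False by blast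
  qed
  moreover have F1: "F1 \<in> Cld X" using assms by (simp add: T4_pairs_def)
  ultimately obtain n where "F1 \<inter> V n = {}"
    using closedin_misses_V by (auto simp: Cld_def)
  then obtain m where "F1 \<inter> V (Suc m) = {}" "F1 \<inter> V m \<noteq> {}"
    using least_V_missing[OF F1] by metis
  with False show thesis by (intro far) auto
qed

lemma sep_set_props:
  assumes "(F1, F2) \<in> T4_pairs X"
  shows "sep_set F1 F2 \<in> Cld X" "topspace X - sep_set F1 F2 \<in> Cld X"
    "F1 \<subseteq> sep_set F1 F2" "F2 \<inter> sep_set F1 F2 = {}"
proof -
  have F: "F1 \<in> Cld X" "F2 \<in> Cld X" "F1 \<inter> F2 = {}" using assms by (auto simp: T4_pairs_def)
  then have FX: "F1 \<subseteq> topspace X" "F2 \<subseteq> topspace X" "F1 \<noteq> {}" "F2 \<noteq> {}"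
    by (auto simp: Cld_def dest: closedin_subset)
  show sub: "F1 \<subseteq> sep_set F1 F2" and disj: "F2 \<inter> sep_set F1 F2 = {}"
    using F(3) by (auto simp: sep_set_def)
  have "closedin X (sep_set F1 F2) \<and> openin X (sep_set F1 F2)"
    using assms
  proof (cases rule: T4_pairs_cases)
    case (near m)
    have "V (Suc m) \<subseteq> topspace X" by (rule openin_subset[OF open_V])
    then show ?thesis
      unfolding sep_set_eq_Un_V[OF near]
      using FX(1) x0_V by (intro conjI closedin_containing openin_containing_V[of _ "Suc m"]) auto
  next
    case (far m)
    then have "x0 \<notin> F1" using x0_V by blast
    then show ?thesis
      unfolding sep_set_eq_fst[OF far] using F(1) FX(1) openin_omitting by (auto simp: Cld_def)
  qed
  then show "sep_set F1 F2 \<in> Cld X" "topspace X - sep_set F1 F2 \<in> Cld X"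
    using sub disj FX by (auto simp: Cld_def)
qed

text \<open>If \<open>F\<close> is finite outside \<open>V n\<close>, then the union with \<open>V n\<close> does not change near \<open>F\<close>: nearby
  sets lie inside this union and contain the finitely many isolated points in \<open>F - V n\<close>.\<close>

lemma Un_V_locally_constant:
  assumes F: "F \<in> Cld X" "finite (F - V n)"
  obtains N where "openin (vietoris X) N" "F \<in> N" "\<And>F'. F' \<in> N \<Longrightarrow> F' \<union> V n = F \<union> V n"
proof -
  have FX: "F \<subseteq> topspace X" using F by (simp add: Cld_def closedin_subset)
  define N where "N = sub_set X (F \<union> V n) \<inter> (\<Inter>x \<in> F - V n. hit_set X {x})"
  have "V n \<subseteq> topspace X" by (rule openin_subset[OF open_V])
  then have "openin X (F \<union> V n)" using FX by (intro openin_containing_V[of _ n]) auto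
  then have opn: "openin (vietoris X) (sub_set X (F \<union> V n))" by (rule openin_sub_set)
  have pts: "openin X {x}" if "x \<in> F - V n" for x
    using that FX x0_V by (intro isolated) auto
  have "openin (vietoris X) N"
  proof (cases "F - V n = {}")
    case True
    then show ?thesis using opn unfolding N_def True by simp
  next
    case False
    then show ?thesis
      unfolding N_def using F(2) opn pts
      by (intro openin_Int openin_INT2 openin_hit_set) auto
  qed
  moreover have "F \<in> N" using F(1) by (auto simp: N_def sub_set_def hit_set_def)
  moreover have "F' \<union> V n = F \<union> V n" if "F' \<in> N" for F'
    using that by (auto simp: N_def sub_set_def hit_set_def)
  ultimately show thesis by (rule that)
qed

lemma sep_set_locally_constant:
  assumes F: "(F1, F2) \<in> T4_pairs X" and fin: "\<And>n. finite (F1 - V n)"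
  shows "\<exists>N1 N2. openin (vietoris X) N1 \<and> openin (vietoris X) N2 \<and> F1 \<in> N1 \<and> F2 \<in> N2 \<and>
    (\<forall>F1' \<in> N1. \<forall>F2' \<in> N2. sep_set F1' F2' = sep_set F1 F2)"
proof -
  have Cld: "F1 \<in> Cld X" "F2 \<in> Cld X" using F by (auto simp: T4_pairs_def)
  then have FX: "F1 \<subseteq> topspace X" "F2 \<subseteq> topspace X"
    by (auto simp: Cld_def dest: closedin_subset)
  have compl_V: "openin X (topspace X - V n)" for n
    using x0_V by (intro openin_omitting) auto
  show ?thesis
    using F
  proof (cases rule: T4_pairs_cases)
    case (near m)
    obtain N where N: "openin (vietoris X) N" "F1 \<in> N"
      "\<And>F'. F' \<in> N \<Longrightarrow> F' \<union> V (Suc m) = F1 \<union> V (Suc m)"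
      using Un_V_locally_constant[OF Cld(1) fin[of "Suc m"]] by metis
    define N1 where "N1 = N \<inter> hit_set X (V (Suc m))"
    define N2 where "N2 = sub_set X (topspace X - V (Suc m)) \<inter> hit_set X (V m)"
    have "openin (vietoris X) N1" "openin (vietoris X) N2"
      unfolding N1_def N2_def
      by (intro openin_Int N(1) openin_hit_set openin_sub_set open_V compl_V)+
    moreover have "F1 \<in> N1" "F2 \<in> N2"
      using N(2) Cld FX near by (auto simp: N1_def N2_def hit_set_def sub_set_def)
    moreover have "sep_set F1' F2' = sep_set F1 F2" if "F1' \<in> N1" "F2' \<in> N2" for F1' F2'
    proof -
      have "F2' \<inter> V (Suc m) = {}" "F2' \<inter> V m \<noteq> {}" "F1' \<inter> V (Suc m) \<noteq> {}"
        using that by (auto simp: N1_def N2_def hit_set_def sub_set_def)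
      then have "sep_set F1' F2' = F1' \<union> V (Suc m)" by (rule sep_set_eq_Un_V)
      then show ?thesis using N(3)[of F1'] that(1) sep_set_eq_Un_V[OF near] by (simp add: N1_def)
    qed
    ultimately show ?thesis by blast
  next
    case (far m)
    obtain N where N: "openin (vietoris X) N" "F1 \<in> N"
      "\<And>F'. F' \<in> N \<Longrightarrow> F' \<union> V (Suc m) = F1 \<union> V (Suc m)"
      using Un_V_locally_constant[OF Cld(1) fin[of "Suc m"]] by metis
    define N1 where "N1 = N \<inter> sub_set X (topspace X - V (Suc m))"
    have "openin (vietoris X) N1" "openin (vietoris X) (hit_set X (V m))"
      unfolding N1_def
      by (intro openin_Int N(1) openin_hit_set openin_sub_set open_V compl_V)+
    moreover have "F1 \<in> N1" "F2 \<in> hit_set X (V m)"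
      using N(2) Cld FX far by (auto simp: N1_def hit_set_def sub_set_def)
    moreover have "sep_set F1' F2' = sep_set F1 F2"
      if "F1' \<in> N1" "F2' \<in> hit_set X (V m)" for F1' F2'
    proof -
      have F': "F1' \<inter> V (Suc m) = {}" "F2' \<inter> V m \<noteq> {}"
        using that by (auto simp: N1_def hit_set_def sub_set_def)
      moreover have "F1' \<union> V (Suc m) = F1 \<union> V (Suc m)" using N(3) that(1) by (simp add: N1_def)
      ultimately have "F1' = F1" using far(1) by blast
      then show ?thesis using sep_set_eq_fst[OF F'] sep_set_eq_fst[OF far] by simp
    qed
    ultimately show ?thesis by blast
  qed
qed

lemma continuously_separatedI:
  assumes T: "T \<subseteq> T4_pairs X"
    and fin: "\<And>F1 F2 n. (F1, F2) \<in> T \<Longrightarrow> finite (F1 - V n)"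
  shows "continuously_separated X T"
proof -
  let ?P = "prod_topology (vietoris X) (vietoris X)"
  define \<phi> where "\<phi> = (\<lambda>(F1, F2). (topspace X - sep_set F1 F2, sep_set F1 F2))"
  have "continuous_map (subtopology ?P T) ?P \<phi>"
  proof (rule continuous_map_locally_constant)
    fix p assume "p \<in> topspace (subtopology ?P T)"
    then obtain F1 F2 where p: "p = (F1, F2)" "(F1, F2) \<in> T" by (cases p) auto
    then have p4: "(F1, F2) \<in> T4_pairs X" using T by blast
    show "\<phi> p \<in> topspace ?P" using sep_set_props[OF p4] by (simp add: \<phi>_def p(1))
    obtain N1 N2 where N: "openin (vietoris X) N1" "openin (vietoris X) N2"
      "F1 \<in> N1" "F2 \<in> N2" "\<forall>F1' \<in> N1. \<forall>F2' \<in> N2. sep_set F1' F2' = sep_set F1 F2"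
      using sep_set_locally_constant[OF p4 fin[OF p(2)]] by blast
    have "openin (subtopology ?P T) ((N1 \<times> N2) \<inter> T)"
      using N by (intro openin_subtopology_Int) (simp add: openin_prod_Times_iff)
    moreover have "\<phi> q = \<phi> p" if "q \<in> (N1 \<times> N2) \<inter> T" for q
    proof (cases q)
      case (Pair F1' F2')
      then have "sep_set F1' F2' = sep_set F1 F2" using that N(5) by blast
      then show ?thesis by (simp add: \<phi>_def p(1) Pair)
    qed
    ultimately show "\<exists>N. openin (subtopology ?P T) N \<and> p \<in> N \<and> (\<forall>q \<in> N. \<phi> q = \<phi> p)"
      using N(3,4) p by blast
  qed
  moreover have "fst (\<phi> (F1, F2)) \<union> snd (\<phi> (F1, F2)) = topspace X \<and>
      F1 \<inter> fst (\<phi> (F1, F2)) = {} \<and> F2 \<inter> snd (\<phi> (F1, F2)) = {}" if "(F1, F2) \<in> T" for F1 F2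
  proof -
    have p: "(F1, F2) \<in> T4_pairs X" using that T by blast
    have "sep_set F1 F2 \<subseteq> topspace X"
      using sep_set_props(1)[OF p] by (simp add: Cld_def closedin_subset)
    then show ?thesis using sep_set_props(3,4)[OF p] by (auto simp: \<phi>_def)
  qed
  ultimately show ?thesis unfolding continuously_separated_def by blast
qed

section \<open>\<open>CT\<^sub>3\<close>, \<open>CT\<^sub>4\<close> and compactness\<close>

lemma CT3: "CT3_space X"
  unfolding CT3_space_def
proof (rule continuously_separatedI)
  show "T3_pairs X \<subseteq> T4_pairs X" by (auto simp: T3_pairs_def)
  show "finite (F1 - V n)" if "(F1, F2) \<in> T3_pairs X" for F1 F2 n
    using that by (auto simp: T3_pairs_def is_singleton_def)
qed

lemma compact_imp_finite_Diff_V: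
  assumes "compact_space X"
  shows "finite (topspace X - V n)"
proof -
  have "compactin X (topspace X - V n)"
    using assms open_V by (intro closedin_compact_space) auto
  moreover have "openin X U" if "U \<in> (\<lambda>x. {x}) ` (topspace X - V n)" for U
    using that isolated x0_V by auto
  moreover have "topspace X - V n \<subseteq> \<Union>((\<lambda>x. {x}) ` (topspace X - V n))" by simp
  ultimately have "\<exists>\<F>. finite \<F> \<and> \<F> \<subseteq> (\<lambda>x. {x}) ` (topspace X - V n) \<and>
      topspace X - V n \<subseteq> \<Union>\<F>"
    by (rule compactinD)
  then obtain \<F> where \<F>: "finite \<F>" "\<F> \<subseteq> (\<lambda>x. {x}) ` (topspace X - V n)"
    "topspace X - V n \<subseteq> \<Union>\<F>"
    by (elim exE conjE)
  have "finite (\<Union>\<F>)" using \<F>(1,2) by (intro finite_Union) auto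
  then show ?thesis by (rule finite_subset[OF \<F>(3)])
qed

lemma finite_Diff_V_imp_compact:
  assumes "\<And>n. finite (topspace X - V n)"
  shows "compact_space X"
  unfolding compact_space_alt
proof (intro allI impI, elim conjE)
  fix \<U> assume \<U>: "\<forall>U \<in> \<U>. openin X U" "topspace X \<subseteq> \<Union>\<U>"
  then obtain U where U: "U \<in> \<U>" "x0 \<in> U" using x0_topspace by blast
  then obtain n where n: "V n \<subseteq> U" using V_base \<U>(1) by blast
  obtain \<F> where "finite \<F>" "\<F> \<subseteq> \<U>" "topspace X - V n \<subseteq> \<Union>\<F>"
    using finite_subset_Union[OF assms[of n], of \<U>] \<U>(2) by blast
  then show "\<exists>\<F>. finite \<F> \<and> \<F> \<subseteq> \<U> \<and> topspace X \<subseteq> \<Union>\<F>"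
    using U n by (intro exI[of _ "insert U \<F>"]) auto
qed

lemma CT4_iff_compact: "CT4_space X \<longleftrightarrow> compact_space X"
proof
  assume compact: "compact_space X"
  show "CT4_space X"
    unfolding CT4_space_def
  proof (rule continuously_separatedI[OF order_refl])
    fix F1 F2 n assume "(F1, F2) \<in> T4_pairs X"
    then have "F1 \<subseteq> topspace X" by (auto simp: T4_pairs_def Cld_def dest: closedin_subset)
    then show "finite (F1 - V n)"
      using compact_imp_finite_Diff_V[OF compact, of n] by (meson Diff_mono finite_subset order_refl)
  qed
next
  assume CT4: "CT4_space X"
  show "compact_space X"
  proof (rule finite_Diff_V_imp_compact, rule ccontr)
    fix n assume "infinite (topspace X - V n)"
    then obtain D where D: "D \<subseteq> topspace X - V n" "infinite D" "countable D"
      using infinite_countable_subset' by blast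
    have "openin X (topspace X - D)"
      using D(1) openin_subset[OF open_V[of n]] by (intro openin_containing_V[of _ n]) auto
    then have "closedin X D" using D(1) by (auto simp: closedin_def)
    moreover have "openin X {x}" if "x \<in> D" for x
      using that D(1) x0_V by (intro isolated) auto
    ultimately show False using not_CT4_space D(2,3) CT4 by blast
  qed
qed

end

section \<open>Metric spaces with one limit point\<close>

theorem theorem4p9:
  fixes M :: "'a set" and d :: "'a \<Rightarrow> 'a \<Rightarrow> real" and x0 :: 'a
  assumes "Metric_space M d"
    and "{x \<in> M. \<not> isolated_point (Metric_space.mtopology M d) x} = {x0}"
  shows "CT3_space (Metric_space.mtopology M d) \<and>
         (CT4_space (Metric_space.mtopology M d) \<longleftrightarrow>
          compact_space (Metric_space.mtopology M d))"
proof -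
  interpret Metric_space M d by (rule assms(1))
  have x0: "x0 \<in> M" using assms(2) by blast
  \<comment> \<open>For positive \<open>n\<close> this is the ball of radius \<open>1 / n\<close> about \<open>x0\<close>; for \<open>n = 0\<close> it is \<open>M\<close>.\<close>
  define V where "V n = {x \<in> M. real n * d x0 x < 1}" for n
  have V_Suc: "V n = mball x0 (1 / real n)" if "n > 0" for n
    using that x0 by (auto simp: V_def field_simps)
  interpret one_limit_point mtopology x0 V
  proof
    show "openin mtopology {x}" if "x \<in> topspace mtopology" "x \<noteq> x0" for x
      using that assms(2) by (auto simp: isolated_point_def)
    show V_0: "V 0 = topspace mtopology" by (simp add: V_def)
    show "openin mtopology (V n)" for n
    proof (cases "n = 0")
      case True
      then show ?thesis using V_0 by (metis openin_topspace)
    next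
      case False
      then show ?thesis by (simp add: V_Suc)
    qed
    show "x0 \<in> V n" for n using x0 by (simp add: V_def)
    show "V n \<subseteq> V m" if "m \<le> n" for m n
    proof -
      have "real m * d x0 x \<le> real n * d x0 x" for x
        using that by (intro mult_right_mono) auto
      then show ?thesis unfolding V_def by (auto intro: le_less_trans)
    qed
    show "\<exists>n. V n \<subseteq> U" if "openin mtopology U" "x0 \<in> U" for U
    proof -
      obtain r where r: "r > 0" "mball x0 r \<subseteq> U"
        using \<open>openin mtopology U\<close> \<open>x0 \<in> U\<close> unfolding openin_mtopology by blast
      then obtain n where n: "n > 0" "1 / real n < r"
        by (metis nat_approx_posE zero_less_Suc)
      then have "V n \<subseteq> mball x0 r" by (auto simp: V_Suc)
      then show ?thesis using r(2) by blast
    qed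
  qed
  show ?thesis using CT3 CT4_iff_compact by blast
qed

end
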